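(* Let $D$ be the formal derivative associated with the grammar $$G=\{s\to s(sx+ty),\ t\to t(sx+ty),\ x\to(s+t)xy,\ y\to(s+t)xy\}.$$ Then for any integer $n\ge0$, $$D^n(y)=\widetilde{N}^A_n(x,y,s,t),$$ where $\widetilde N_0^A(x,y,s,t)=y$ and, for $n\ge1$, $$\widetilde{N}^A_n(x,y,s,t)=\sum_{k=1}^n\sum_{r=0}^n\widetilde{N}(n,k,r)\,s^{n-r}t^rx^ky^{n-k+1},$$ with $\widetilde N(n,k,r)$ the number of labeled plane trees on $[n+1]$ with $k$ leaves and $r$ improper edges.
   Context: The formal derivative associated with a grammar (a set of substitution rules $v\to p_v$, $v$ a variable) is the linear operator $D$ on Laurent polynomials in the variables with $D(v)=p_v$ for each rule, $D(u+w)=D(u)+D(w)$, $D(uw)=D(u)w+uD(w)$. A labeled plane tree on $[m]=\{1,\dots,m\}$ is a rooted plane tree (the children of each node are linearly ordered from left to right) with $m$ nodes labeled bijectively by $[m]$. Node with label $i$ is written $\mathbf{i}$. A leaf is a node with no children. Siblings to the left of a node are its elder siblings. For a node $\mathbf{j}$, $\beta(\mathbf{j})$ is the smallest label of a node in the subtree rooted at $\mathbf{j}$ (including $\mathbf{j}$). For a non-root node $\mathbf{j}$ with parent $\mathbf{i}$ and elder siblings $\mathbf{k}_1,\dots,\mathbf{k}_{r}$, $\alpha(\mathbf{j})=\min(i,\beta(\mathbf{k}_1),\dots,\beta(\mathbf{k}_r))$. An edge $(\mathbf{i},\mathbf{j})$ with parent $\mathbf{i}$ and child $\mathbf{j}$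 is proper if $\alpha(\mathbf{j})<\beta(\mathbf{j})$, and improper otherwise. *)

theory Defs
  imports "HOL-Library.Poly_Mapping"
begin

(* A Laurent polynomial is a finitely supported map from Laurent monomials
   to coefficients, a Laurent monomial being a finitely supported integer exponent vector. *)
type_synonym ('v, 'a) laurent = "('v \<Rightarrow>\<^sub>0 int) \<Rightarrow>\<^sub>0 'a"

definition var :: "'v \<Rightarrow> ('v, 'a::comm_ring_1) laurent" where
  "var v = Poly_Mapping.single (Poly_Mapping.single v 1) 1"

definition const :: "'a \<Rightarrow> ('v, 'a::comm_ring_1) laurent" where
  "const c = Poly_Mapping.single 0 c"

(* A grammar is the family p of the right-hand sides of its rules v -> p v. *)
definition formal_derivative ::
  "('v \<Rightarrow> ('v, 'a::comm_ring_1) laurent) \<Rightarrow> (('v, 'a) laurent \<Rightarrow> ('v, 'a) laurent) \<Rightarrow> bool" where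
  "formal_derivative p D \<longleftrightarrow>
     (\<forall>v. D (var v) = p v) \<and>
     (\<forall>c u. D (const c * u) = const c * D u) \<and>
     (\<forall>u w. D (u + w) = D u + D w) \<and>
     (\<forall>u w. D (u * w) = D u * w + u * D w)"

lemma formal_derivativeD:
  assumes "formal_derivative p D"
  shows "D (var v) = p v" "D (const c * u) = const c * D u"
    "D (u + w) = D u + D w" "D (u * w) = D u * w + u * D w"
  using assms unfolding formal_derivative_def by blast+

lemma poly_mapping_single_add_induct [case_names single add]:
  assumes "\<And>m c. P (Poly_Mapping.single m c)" "\<And>f g. P f \<Longrightarrow> P g \<Longrightarrow> P (f + g)"
  shows "P (f :: 'b \<Rightarrow>\<^sub>0 'a::monoid_add)"
proof (induction f rule: update_induct)
  case const
  show ?case using assms(1)[of undefined 0] by simp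
next
  case (update f a b)
  have "Poly_Mapping.update a b f = f + Poly_Mapping.single a b"
    using update.hyps(1)
    by (intro poly_mapping_eqI) (auto simp: lookup_update lookup_add lookup_single when_def in_keys_iff)
  then show ?case using assms update.IH by simp
qed

lemma single_eq_const_times:
  "Poly_Mapping.single m (c::'a::comm_ring_1) = const c * Poly_Mapping.single m 1"
  by (simp add: const_def mult_single)

definition monom_deriv ::
  "('v \<Rightarrow> ('v, 'a::comm_ring_1) laurent) \<Rightarrow> ('v \<Rightarrow>\<^sub>0 int) \<Rightarrow> ('v, 'a) laurent" where
  "monom_deriv p m = (\<Sum>v\<in>Poly_Mapping.keys m.
     Poly_Mapping.single (m - Poly_Mapping.single v 1) (of_int (Poly_Mapping.lookup m v)) * p v)"

lemma monom_deriv_superset: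
  assumes "finite A" "Poly_Mapping.keys m \<subseteq> A"
  shows "monom_deriv p m = (\<Sum>v\<in>A.
     Poly_Mapping.single (m - Poly_Mapping.single v 1) (of_int (Poly_Mapping.lookup m v)) * p v)"
  unfolding monom_deriv_def using assms
  by (intro sum.mono_neutral_left) (auto simp: in_keys_iff)

lemma monom_deriv_add:
  "monom_deriv p (m + n) =
     monom_deriv p m * Poly_Mapping.single n 1 + Poly_Mapping.single m 1 * monom_deriv p n"
proof -
  let ?A = "Poly_Mapping.keys m \<union> Poly_Mapping.keys n"
  have fin: "finite ?A" by simp
  have sub: "Poly_Mapping.keys (m + n) \<subseteq> ?A" by (rule Poly_Mapping.keys_add)
  have "Poly_Mapping.single (m + n - Poly_Mapping.single v 1) (of_int (Poly_Mapping.lookup (m + n) v)) * p v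
      = Poly_Mapping.single (m - Poly_Mapping.single v 1) (of_int (Poly_Mapping.lookup m v)) * p v
          * Poly_Mapping.single n 1
        + Poly_Mapping.single m 1
          * (Poly_Mapping.single (n - Poly_Mapping.single v 1) (of_int (Poly_Mapping.lookup n v)) * p v)"
    (is "Poly_Mapping.single ?e (of_int ?c) * _ = ?a * _ * ?n + ?m * (?b * _)") for v
  proof -
    have c: "Poly_Mapping.single ?e (of_int ?c) = ?a * ?n + ?m * ?b"
      by (simp only: mult_single lookup_add of_int_add single_add mult_1_left mult_1_right
            add_diff_eq diff_add_eq)
    show ?thesis
      unfolding c by (simp only: distrib_left distrib_right mult.assoc mult.commute mult.left_commute)
  qed
  then show ?thesis
    unfolding monom_deriv_superset[OF fin sub] monom_deriv_superset[OF fin Un_upper1]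
      monom_deriv_superset[OF fin Un_upper2]
    by (simp only: sum_distrib_left sum_distrib_right sum.distrib)
qed

definition laurent_deriv ::
  "('v \<Rightarrow> ('v, 'a::comm_ring_1) laurent) \<Rightarrow> ('v, 'a) laurent \<Rightarrow> ('v, 'a) laurent" where
  "laurent_deriv p u =
     (\<Sum>m\<in>Poly_Mapping.keys u. const (Poly_Mapping.lookup u m) * monom_deriv p m)"

lemma laurent_deriv_superset:
  assumes "finite A" "Poly_Mapping.keys u \<subseteq> A"
  shows "laurent_deriv p u = (\<Sum>m\<in>A. const (Poly_Mapping.lookup u m) * monom_deriv p m)"
  unfolding laurent_deriv_def using assms
  by (intro sum.mono_neutral_left) (auto simp: in_keys_iff const_def)

lemma laurent_deriv_add: "laurent_deriv p (u + w) = laurent_deriv p u + laurent_deriv p w"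
proof -
  let ?A = "Poly_Mapping.keys u \<union> Poly_Mapping.keys w"
  have fin: "finite ?A" by simp
  have sub: "Poly_Mapping.keys (u + w) \<subseteq> ?A" by (rule Poly_Mapping.keys_add)
  show ?thesis
    unfolding laurent_deriv_superset[OF fin sub]
      laurent_deriv_superset[OF fin Un_upper1]
      laurent_deriv_superset[OF fin Un_upper2]
    by (simp add: sum.distrib[symmetric] lookup_add const_def single_add distrib_right)
qed

lemma laurent_deriv_single:
  "laurent_deriv p (Poly_Mapping.single m c) = const c * monom_deriv p m"
  by (cases "c = 0") (simp_all add: laurent_deriv_def const_def)

lemma laurent_deriv_mult:
  "laurent_deriv p (u * w) = laurent_deriv p u * w + u * laurent_deriv p w"
proof (induction u rule: poly_mapping_single_add_induct)
  case (single m c)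
  show ?case
  proof (induction w rule: poly_mapping_single_add_induct)
    case (single n d)
    have "const (c * d) = (const c * const d :: ('a, 'b) laurent)"
      by (simp add: const_def mult_single)
    moreover have "Poly_Mapping.single m c * const d * monom_deriv p n
        = const c * const d * (Poly_Mapping.single m 1 * monom_deriv p n)"
      by (subst single_eq_const_times) (simp only: ac_simps)
    moreover have "const c * monom_deriv p m * Poly_Mapping.single n d
        = const c * const d * (monom_deriv p m * Poly_Mapping.single n 1)"
      by (subst single_eq_const_times[of n]) (simp only: ac_simps)
    ultimately show ?case
      by (simp only: mult_single laurent_deriv_single monom_deriv_add distrib_left mult.assoc)
  qed (simp add: laurent_deriv_add algebra_simps)
qed (simp add: laurent_deriv_add algebra_simps)

lemma formal_derivative_laurent_deriv: "formal_derivative p (laurent_deriv p)"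
  unfolding formal_derivative_def
proof (intro conjI allI)
  show "laurent_deriv p (var v) = p v" for v
    by (simp add: var_def laurent_deriv_single monom_deriv_def const_def)
  show "laurent_deriv p (const c * u) = const c * laurent_deriv p u" for c u
    by (simp add: laurent_deriv_mult laurent_deriv_single const_def monom_deriv_def)
qed (simp_all add: laurent_deriv_add laurent_deriv_mult)

lemma formal_derivative_unique:
  assumes "formal_derivative p D" "formal_derivative p E"
  shows "D = E"
proof -
  define F where "F u = D u - E u" for u
  note D = formal_derivativeD[OF assms(1)] and E = formal_derivativeD[OF assms(2)]
  have Fv: "F (var v) = 0" for v
    by (simp only: F_def D(1) E(1) diff_self)
  have Fc: "F (const c * u) = const c * F u" for c u
    by (simp only: F_def D(2) E(2) right_diff_distrib)
  have Fa: "F (u + w) = F u + F w" for u w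
    unfolding F_def D(3) E(3) by simp
  have Fm: "F (u * w) = F u * w + u * F w" for u w
    unfolding F_def D(4) E(4) by (simp add: algebra_simps)
  have F1: "F 1 = 0" using Fm[of 1 1] by simp
  have inv: "F b = 0" if "a * b = 1" "F a = 0" for a b
  proof -
    have "a * F b = 0" using Fm[of a b] that F1 by simp
    then have "b * (a * F b) = 0" by simp
    then show ?thesis using that by (metis mult.assoc mult.commute mult.left_neutral)
  qed
  have Fn: "F (Poly_Mapping.single (Poly_Mapping.single v (int k)) 1) = 0" for v k
  proof (induction k)
    case 0
    then show ?case using F1 by simp
  next
    case (Suc k)
    have "Poly_Mapping.single (Poly_Mapping.single v (int (Suc k))) (1::'b)
        = var v * Poly_Mapping.single (Poly_Mapping.single v (int k)) 1"
      by (simp add: var_def mult_single single_add[symmetric])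
    then show ?case using Suc by (simp add: Fm Fv)
  qed
  have Fz: "F (Poly_Mapping.single (Poly_Mapping.single v z) 1) = 0" for v z
  proof (cases "z \<ge> 0")
    case True
    then show ?thesis using Fn[of v "nat z"] by simp
  next
    case False
    have "Poly_Mapping.single (Poly_Mapping.single v (int (nat (- z)))) (1::'b) *
        Poly_Mapping.single (Poly_Mapping.single v z) 1 = 1"
      using False by (simp add: mult_single single_add[symmetric])
    then show ?thesis using inv Fn by blast
  qed
  have Fmon: "F (Poly_Mapping.single m 1) = 0" for m
  proof (induction m rule: poly_mapping_single_add_induct)
    case (single k v)
    then show ?case by (rule Fz)
  next
    case (add f g)
    have "Poly_Mapping.single (f + g) (1::'b) = Poly_Mapping.single f 1 * Poly_Mapping.single g 1"
      by (simp add: mult_single)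
    then show ?case using add by (simp add: Fm)
  qed
  have "F u = 0" for u
  proof (induction u rule: poly_mapping_single_add_induct)
    case (single m c)
    then show ?case using Fc[of c "Poly_Mapping.single m 1"] Fmon
      by (metis mult_zero_right single_eq_const_times)
  next
    case (add f g)
    then show ?case by (simp add: Fa)
  qed
  then show ?thesis by (auto simp: F_def)
qed

theorem ex1_formal_derivative: "\<exists>!D. formal_derivative p D"
  using formal_derivative_laurent_deriv formal_derivative_unique by blast

datatype gvar = S | T | X | Y

fun grammar_G :: "gvar \<Rightarrow> (gvar, 'a::comm_ring_1) laurent" where
  "grammar_G S = var S * (var S * var X + var T * var Y)"
| "grammar_G T = var T * (var S * var X + var T * var Y)"
| "grammar_G X = (var S + var T) * var X * var Y"
| "grammar_G Y = (var S + var T) * var X * var Y"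

(* The list of children is ordered from left to right. *)
datatype plane_tree = Node nat "plane_tree list"

fun labels :: "plane_tree \<Rightarrow> nat list" where
  "labels (Node i ts) = i # concat (map labels ts)"

definition labeled_plane_trees :: "nat \<Rightarrow> plane_tree set" where
  "labeled_plane_trees m = {t. distinct (labels t) \<and> set (labels t) = {1..m}}"

fun leaves :: "plane_tree \<Rightarrow> nat" where
  "leaves (Node i ts) = (if ts = [] then 1 else sum_list (map leaves ts))"

definition beta :: "plane_tree \<Rightarrow> nat" where
  "beta t = Min (set (labels t))"

(* alpha i ts j and proper i ts j concern the edge from a node labeled i with children ts
   to its child ts ! j; the elder siblings of that child are take j ts. *)
definition alpha :: "nat \<Rightarrow> plane_tree list \<Rightarrow> nat \<Rightarrow> nat" where
  "alpha i ts j = Min (insert i (beta ` set (take j ts)))"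

definition proper :: "nat \<Rightarrow> plane_tree list \<Rightarrow> nat \<Rightarrow> bool" where
  "proper i ts j \<longleftrightarrow> alpha i ts j < beta (ts ! j)"

fun improper_edges :: "plane_tree \<Rightarrow> nat" where
  "improper_edges (Node i ts) =
     card {j. j < length ts \<and> \<not> proper i ts j} + sum_list (map improper_edges ts)"

definition N_tilde :: "nat \<Rightarrow> nat \<Rightarrow> nat \<Rightarrow> nat" where
  "N_tilde n k r =
     card {t \<in> labeled_plane_trees (n + 1). leaves t = k \<and> improper_edges t = r}"

lemma finite_plane_trees_bounded:
  assumes "finite A"
  shows "finite {t. length (labels t) \<le> m \<and> set (labels t) \<subseteq> A}"
proof (induction m)
  case 0
  have "{t. length (labels t) \<le> 0 \<and> set (labels t) \<subseteq> A} = {}"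
  proof -
    have "labels t \<noteq> []" for t by (cases t) simp
    then show ?thesis by auto
  qed
  then show ?case by simp
next
  case (Suc m)
  let ?B = "{t. length (labels t) \<le> m \<and> set (labels t) \<subseteq> A}"
  let ?L = "{ts. set ts \<subseteq> ?B \<and> length ts \<le> m}"
  have len: "length ts \<le> length (concat (map labels ts))" for ts
  proof (induction ts)
    case (Cons t ts)
    then show ?case by (cases t) simp
  qed simp
  have mem: "length (labels t) \<le> length (concat (map labels ts))" if "t \<in> set ts" for t ts
    using that by (induction ts) auto
  have "{t. length (labels t) \<le> Suc m \<and> set (labels t) \<subseteq> A} \<subseteq> (\<lambda>(i, ts). Node i ts) ` (A \<times> ?L)"
  proof
    fix t assume t: "t \<in> {t. length (labels t) \<le> Suc m \<and> set (labels t) \<subseteq> A}"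
    obtain i ts where eq: "t = Node i ts" by (cases t)
    have l: "length (concat (map labels ts)) \<le> m" and i: "i \<in> A"
      and s: "\<forall>u\<in>set ts. set (labels u) \<subseteq> A"
      using t by (auto simp: eq)
    have "length (labels u) \<le> m" if "u \<in> set ts" for u
      using mem[OF that] l by (rule order_trans)
    moreover have "length ts \<le> m" using len l by (rule order_trans)
    ultimately have "ts \<in> ?L" using s by simp blast
    then show "t \<in> (\<lambda>(i, ts). Node i ts) ` (A \<times> ?L)" using i eq by force
  qed
  moreover have "finite ?L" using Suc finite_lists_length_le by blast
  ultimately show ?case using assms by (meson finite_SigmaI finite_imageI finite_subset)
qed

lemma finite_labeled_plane_trees: "finite (labeled_plane_trees m)"
proof (rule finite_subset)
  show "labeled_plane_trees m \<subseteq> {t. length (labels t) \<le> m \<and> set (labels t) \<subseteq> {1..m}}"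
  proof
    fix t assume "t \<in> labeled_plane_trees m"
    then have d: "distinct (labels t)" and s: "set (labels t) = {1..m}"
      by (simp_all add: labeled_plane_trees_def)
    show "t \<in> {t. length (labels t) \<le> m \<and> set (labels t) \<subseteq> {1..m}}"
      using distinct_card[OF d] s by simp
  qed
  show "finite {t. length (labels t) \<le> m \<and> set (labels t) \<subseteq> {1..m}}"
    by (rule finite_plane_trees_bounded) simp
qed

definition N_tilde_A :: "nat \<Rightarrow> 'b::comm_semiring_1 \<Rightarrow> 'b \<Rightarrow> 'b \<Rightarrow> 'b \<Rightarrow> 'b" where
  "N_tilde_A n x y s t =
     (if n = 0 then y
      else \<Sum>k=1..n. \<Sum>r=0..n. of_nat (N_tilde n k r) * s ^ (n - r) * t ^ r * x ^ k * y ^ (n - k + 1))"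

end

theory Submission
  imports Defs "HOL-Library.Multiset"
begin

text \<open>
  Give a tree the weight \<open>s\<close> per proper edge, \<open>t\<close> per improper edge, \<open>x\<close> per leaf and \<open>y\<close> per
  internal node. Every tree on \<open>[n+2]\<close> arises exactly once from a tree on \<open>[n+1]\<close> by choosing a node
  \<open>v\<close> and one of the \<open>d+1\<close> gaps between its \<open>d\<close> children, and then either inserting the maximal
  label \<open>m = n+2\<close> as a leaf in that gap, or splitting \<open>v\<close> at that gap: \<open>v\<close> keeps the children to
  the left, and \<open>m\<close> takes the place of \<open>v\<close>, with children \<open>v\<close> followed by the children to the right of
  the gap. Neither operation changes the type of an old edge; the new edge is proper in the first
  case and improper in the second. Hence a node contributes \<open>sxy + txy\<close> and each edge an extra
  factor \<open>sx + ty\<close>, which is exactly the effect of the grammar.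
\<close>

section \<open>Inserting and deleting a label\<close>

text \<open>The forest version treats the children of a node: a new leaf goes into a gap, or the
  insertion happens inside one of the trees. Splitting the node itself is left to
  \<open>insert_label\<close>.\<close>

fun insert_label :: "nat \<Rightarrow> plane_tree \<Rightarrow> plane_tree list"
  and insert_label_forest :: "nat \<Rightarrow> plane_tree list \<Rightarrow> plane_tree list list" where
  "insert_label m (Node i ts) =
     map (\<lambda>p. Node m (Node i (take p ts) # drop p ts)) [0..<Suc (length ts)]
     @ map (Node i) (insert_label_forest m ts)"
| "insert_label_forest m [] = [[Node m []]]"
| "insert_label_forest m (u # us) =
     (Node m [] # u # us)
     # map (\<lambda>u'. u' # us) (insert_label m u) @ map ((#) u) (insert_label_forest m us)"

text \<open>A root \<open>m\<close> is merged back into its first child, and a leaf \<open>m\<close>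
  is dropped from its siblings. The value at \<open>Node m []\<close> is a dummy, as no tree would
  remain.\<close>

fun delete_label :: "nat \<Rightarrow> plane_tree \<Rightarrow> plane_tree"
  and delete_label_forest :: "nat \<Rightarrow> plane_tree list \<Rightarrow> plane_tree list" where
  "delete_label m (Node i ts) =
     (if i = m then (case ts of Node j us # vs \<Rightarrow> Node j (us @ vs) | [] \<Rightarrow> Node i [])
      else Node i (delete_label_forest m ts))"
| "delete_label_forest m [] = []"
| "delete_label_forest m (u # us) =
     (if u = Node m [] then delete_label_forest m us
      else delete_label m u # delete_label_forest m us)"

abbreviation forest_labels :: "plane_tree list \<Rightarrow> nat list" where
  "forest_labels us \<equiv> concat (map labels us)"

lemma labels_nonempty [simp]: "labels t \<noteq> []"
  by (cases t) simp

lemma mset_labels_insert_label: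
  "t' \<in> set (insert_label m t) \<Longrightarrow> mset (labels t') = add_mset m (mset (labels t))"
  "us' \<in> set (insert_label_forest m us) \<Longrightarrow>
     mset (forest_labels us') = add_mset m (mset (forest_labels us))"
proof (induction m t and m us arbitrary: t' and us' rule: insert_label_insert_label_forest.induct)
  case (1 m i ts)
  have "forest_labels ts = forest_labels (take p ts) @ forest_labels (drop p ts)" for p
    by (metis append_take_drop_id concat_append map_append)
  then have "mset (forest_labels ts) =
      mset (forest_labels (take p ts)) + mset (forest_labels (drop p ts))" for p
    by (metis mset_append)
  then show ?case using 1 by (auto simp del: map_append)
qed auto

lemma delete_label_id:
  "m \<notin> set (labels t) \<Longrightarrow> delete_label m t = t"
  "m \<notin> set (forest_labels us) \<Longrightarrow> delete_label_forest m us = us"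
  by (induction m t and m us rule: delete_label_delete_label_forest.induct) auto

text \<open>The result has at least two nodes. So a new \<open>Node m []\<close> in a forest can
  only come from a gap, which lets deletion tell the cases apart.\<close>

lemma insert_label_neq_leaf: "Node m [] \<notin> set (insert_label m t)"
proof
  assume "Node m [] \<in> set (insert_label m t)"
  from mset_labels_insert_label(1)[OF this] show False by simp
qed

lemma delete_insert_label:
  "t' \<in> set (insert_label m t) \<Longrightarrow> m \<notin> set (labels t) \<Longrightarrow> delete_label m t' = t"
  "us' \<in> set (insert_label_forest m us) \<Longrightarrow> m \<notin> set (forest_labels us) \<Longrightarrow>
     delete_label_forest m us' = us"
proof (induction m t and m us arbitrary: t' and us' rule: insert_label_insert_label_forest.induct)
  case (3 m u us)
  then show ?case using insert_label_neq_leaf by (auto simp: delete_label_id)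
qed auto

lemma insert_delete_label:
  "count (mset (labels t)) m = 1 \<Longrightarrow> t \<noteq> Node m [] \<Longrightarrow> t \<in> set (insert_label m (delete_label m t))"
  "count (mset (forest_labels us)) m = 1 \<Longrightarrow> us \<in> set (insert_label_forest m (delete_label_forest m us))"
proof (induction m t and m us rule: delete_label_delete_label_forest.induct)
  case (1 m i ts)
  show ?case
  proof (cases "i = m")
    case True
    with 1 obtain j us vs where ts: "ts = Node j us # vs"
      by (metis list.exhaust plane_tree.exhaust)
    \<comment> \<open>The split took place at the gap just after the children kept by
      \<open>j\<close>.\<close>
    show ?thesis using True by (auto simp: ts image_iff intro!: bexI[of _ "length us"])
  next
    case False
    with 1 show ?thesis by auto
  qed
next
  case (3 m u us)
  have sum1: "count (mset (labels u)) m + count (mset (forest_labels us)) m = 1"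
    using 3(4) by simp
  consider "u = Node m []" | "u \<noteq> Node m []" "m \<in> set (labels u)" | "m \<notin> set (labels u)"
    by blast
  then show ?case
  proof cases
    case 1
    then have "m \<notin> set (forest_labels us)"
      using 3(4) by (simp del: set_concat add: count_eq_zero_iff)
    then show ?thesis using 1 by (cases us) (auto simp: delete_label_id)
  next
    case 2
    then have "count (mset (labels u)) m > 0" by simp
    then have "count (mset (labels u)) m = 1" "count (mset (forest_labels us)) m = 0"
      using sum1 by linarith+
    then show ?thesis using 2 3(1-3) by (auto simp: delete_label_id count_eq_zero_iff)
  next
    case c: 3
    then have "count (mset (labels u)) m = 0" by (simp add: count_eq_zero_iff)
    then have "count (mset (forest_labels us)) m = 1" using sum1 by linarith
    moreover have "u \<noteq> Node m []" using c by auto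
    ultimately show ?thesis using 3 c by (auto simp: delete_label_id)
  qed
qed auto

lemma distinct_insert_label:
  "m \<notin> set (labels t) \<Longrightarrow> distinct (insert_label m t)"
  "m \<notin> set (forest_labels us) \<Longrightarrow> distinct (insert_label_forest m us)"
proof (induction m t and m us rule: insert_label_insert_label_forest.induct)
  case (1 m i ts)
  \<comment> \<open>The lengths of the two parts determine the cut position.\<close>
  have "inj_on (\<lambda>p. Node m (Node i (take p ts) # drop p ts)) {0..<Suc (length ts)}"
    by (auto simp: inj_on_def dest!: arg_cong[where f = length])
  then show ?case using 1 by (auto simp: distinct_map inj_on_def simp del: upt_Suc)
next
  case (3 m u us)
  \<comment> \<open>This separates insertions inside \<open>u\<close> from those further right,
    which keep \<open>u\<close>.\<close>
  have "u \<notin> set (insert_label m u)"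
    using mset_labels_insert_label(1) by fastforce
  then show ?case using 3 insert_label_neq_leaf[of m u] by (auto simp: distinct_map inj_on_def)
qed auto

section \<open>Generating the trees on a label set by inserting a new label\<close>

definition trees_on :: "nat set \<Rightarrow> plane_tree set" where
  "trees_on A = {t. distinct (labels t) \<and> set (labels t) = A}"

lemma trees_on_iff: "finite A \<Longrightarrow> t \<in> trees_on A \<longleftrightarrow> mset (labels t) = mset_set A"
proof
  assume "t \<in> trees_on A"
  then show "mset (labels t) = mset_set A" using mset_set_set[of "labels t"] by (simp add: trees_on_def)
next
  assume fin: "finite A" and eq: "mset (labels t) = mset_set A"
  have set: "set (labels t) = A"
    using arg_cong[OF eq, of set_mset] fin by simp
  have "distinct (labels t)"
    unfolding distinct_count_atmost_1 eq set using fin by simp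
  then show "t \<in> trees_on A" using set by (simp add: trees_on_def)
qed

text \<open>The lists \<open>insert_label m t\<close> partition the larger set: they cover it
  because deletion can be undone, and they are disjoint because deletion recovers \<open>t\<close>.
  As \<open>A\<close> is nonempty, \<open>Node m []\<close> does not occur.\<close>

lemma sum_trees_on_insert:
  assumes "finite A" "A \<noteq> {}" "m \<notin> A"
  shows "sum f (trees_on (insert m A)) = (\<Sum>t\<in>trees_on A. sum_list (map f (insert_label m t)))"
proof -
  have mem: "m \<notin> set (labels t)" if "t \<in> trees_on A" for t
    using that assms by (auto simp: trees_on_def)
  have fin: "finite (trees_on A)"
    by (rule finite_subset[OF _ finite_plane_trees_bounded[OF assms(1), of "card A"]])
      (auto simp: trees_on_def distinct_card[symmetric])
  have eq: "trees_on (insert m A) = (\<Union>t\<in>trees_on A. set (insert_label m t))"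
  proof (intro equalityI subsetI)
    fix t' assume t': "t' \<in> trees_on (insert m A)"
    then have *: "mset (labels t') = add_mset m (mset_set A)"
      using assms by (simp add: trees_on_iff)
    then have "t' \<noteq> Node m []" using assms by (auto simp: mset_set_empty_iff)
    moreover have "count (mset (labels t')) m = 1" using * assms by simp
    ultimately have i: "t' \<in> set (insert_label m (delete_label m t'))"
      by (intro insert_delete_label)
    then have "delete_label m t' \<in> trees_on A"
      using mset_labels_insert_label(1)[OF i] * assms by (simp add: trees_on_iff)
    then show "t' \<in> (\<Union>t\<in>trees_on A. set (insert_label m t))" using i by blast
  next
    fix t' assume "t' \<in> (\<Union>t\<in>trees_on A. set (insert_label m t))"
    then show "t' \<in> trees_on (insert m A)"
      using assms mset_labels_insert_label(1) by (auto simp: trees_on_iff)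
  qed
  have "sum f (trees_on (insert m A)) = (\<Sum>t\<in>trees_on A. sum f (set (insert_label m t)))"
    unfolding eq
  proof (rule sum.UNION_disjoint[OF fin])
    show "\<forall>t\<in>trees_on A. \<forall>u\<in>trees_on A. t \<noteq> u \<longrightarrow>
        set (insert_label m t) \<inter> set (insert_label m u) = {}"
      using delete_insert_label(1) mem by blast
  qed simp
  then show ?thesis
    using mem by (simp add: sum_list_distinct_conv_sum_set distinct_insert_label)
qed

section \<open>Weights\<close>

text \<open>In \<open>forest_weight\<close>, the argument \<open>a\<close> is the value of \<open>\<alpha>\<close> at the first tree of the forest.\<close>

fun tree_weight :: "'b::comm_semiring_1 \<Rightarrow> 'b \<Rightarrow> 'b \<Rightarrow> 'b \<Rightarrow> plane_tree \<Rightarrow> 'b"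
  and forest_weight :: "'b::comm_semiring_1 \<Rightarrow> 'b \<Rightarrow> 'b \<Rightarrow> 'b \<Rightarrow> nat \<Rightarrow> plane_tree list \<Rightarrow> 'b" where
  "tree_weight s t x y (Node i us) = (if us = [] then x else y) * forest_weight s t x y i us"
| "forest_weight s t x y a [] = 1"
| "forest_weight s t x y a (u # us) =
     (if a < beta u then s else t) * tree_weight s t x y u * forest_weight s t x y (min a (beta u)) us"

section \<open>Subtree minima and the weight of a split\<close>

lemma beta_add_label: "mset (labels t') = add_mset m (mset (labels t)) \<Longrightarrow> beta t' = min m (beta t)"
proof -
  assume "mset (labels t') = add_mset m (mset (labels t))"
  then have "set (labels t') = insert m (set (labels t))"
    by (metis set_mset_add_mset_insert set_mset_mset)
  then show ?thesis by (simp add: beta_def)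
qed

lemma beta_less: "\<forall>i\<in>set (labels t). i < m \<Longrightarrow> beta t < m"
  by (cases t) (auto simp: beta_def Min_less_iff)

text \<open>A maximal new label never becomes the minimum of a nonempty tree; this is why old edges
  keep their type.\<close>

lemma beta_insert_label:
  "t' \<in> set (insert_label m t) \<Longrightarrow> \<forall>i\<in>set (labels t). i < m \<Longrightarrow> beta t' = beta t"
  using beta_add_label mset_labels_insert_label(1) beta_less by fastforce

text \<open>Hence \<open>beta (Node i us)\<close> is also the value of \<alpha> at a child that
  follows the siblings \<open>us\<close>.\<close>

lemma beta_Node: "beta (Node i us) = Min (insert i (beta ` set us))"
proof (induction us rule: rev_induct)
  case Nil
  then show ?case by (simp add: beta_def)
next
  case (snoc u us)
  have "beta (Node i (us @ [u])) = min (beta u) (beta (Node i us))"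
    using Min_Un[of "set (labels u)" "set (labels (Node i us))"]
    by (simp add: beta_def Un_commute del: set_concat)
  also have "\<dots> = Min (insert i (beta ` set (us @ [u])))"
    unfolding snoc.IH by (cases "us = []") (simp_all add: min.left_commute min.commute)
  finally show ?case .
qed

lemma beta_Node_Cons: "Min (insert (min i (beta u)) (beta ` set us)) = Min (insert i (beta ` set (u # us)))"
proof -
  have "Min (insert i (insert (beta u) (beta ` set us))) = Min (insert (min i (beta u)) (beta ` set us))"
    by (cases "us = []") (simp_all add: min.assoc)
  then show ?thesis by simp
qed

lemma forest_weight_append:
  "forest_weight s t x y a (us @ vs) =
     forest_weight s t x y a us * forest_weight s t x y (beta (Node a us)) vs"
proof (induction us arbitrary: a)
  case Nil
  then show ?case by (simp add: beta_Node)
next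
  case (Cons u us)
  then show ?case by (simp add: beta_Node beta_Node_Cons[symmetric] mult.assoc del: list.set)
qed

text \<open>The edge from \<open>m\<close> to \<open>i\<close> is improper as \<open>m\<close> is
  large. The children moved to \<open>m\<close> then see the minimum of \<open>i\<close> and the
  children left behind, which is the \<alpha> they had before. Node \<open>i\<close> becomes or
  stays a leaf if nothing is left to it.\<close>

lemma weight_split:
  assumes "i < m" "p \<le> length us"
  shows "tree_weight s t x y (Node m (Node i (take p us) # drop p us)) =
           t * y * (if p = 0 \<or> us = [] then x else y) * forest_weight s t x y i us"
proof -
  have b: "beta (Node i (take p us)) < m"
    using assms unfolding beta_Node by (subst Min_less_iff) auto
  have "forest_weight s t x y i us = forest_weight s t x y i (take p us) *
      forest_weight s t x y (beta (Node i (take p us))) (drop p us)"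
    using forest_weight_append[of s t x y i "take p us" "drop p us"] by simp
  then show ?thesis using b by (auto simp: min_absorb2 ac_simps)
qed

text \<open>The first gap makes \<open>i\<close> a leaf and gives \<open>x\<close>; each of the
  other \<open>length us\<close> gaps gives \<open>y\<close>.\<close>

lemma sum_list_weight_split:
  fixes s t x y :: "'b::comm_semiring_1"
  assumes "i < m"
  shows "sum_list (map (\<lambda>p. tree_weight s t x y (Node m (Node i (take p us) # drop p us)))
           [0..<Suc (length us)]) =
         t * y * (x + of_nat (length us) * y) * forest_weight s t x y i us" (is "?L = ?R")
proof -
  let ?g = "\<lambda>p. tree_weight s t x y (Node m (Node i (take p us) # drop p us))"
  let ?W = "forest_weight s t x y i us"
  have "?L = sum ?g {0..<Suc (length us)}"
    by (simp only: interv_sum_list_conv_sum_set_nat set_upt)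
  also have "\<dots> = ?g 0 + (\<Sum>p<length us. ?g (Suc p))"
    unfolding atLeast0LessThan by (rule sum.lessThan_Suc_shift)
  also have "(\<Sum>p<length us. ?g (Suc p)) = (\<Sum>p<length us. t * y * y * ?W)"
    using assms by (intro sum.cong refl, subst weight_split) auto
  also have "?g 0 = t * y * x * ?W"
    using assms by (subst weight_split) auto
  finally show ?thesis by (simp add: algebra_simps)
qed

section \<open>The derivation acts by insertion\<close>

text \<open>Insertion mirrors only the sum rule, the product rule and the four rules of the grammar,
  so the argument runs in any commutative ring.\<close>

locale grammar_derivation =
  fixes D :: "'b::comm_ring_1 \<Rightarrow> 'b" and s t x y :: 'b
  assumes D_add: "D (u + w) = D u + D w"
    and D_mult: "D (u * w) = D u * w + u * D w"
    and D_s: "D s = s * (s * x + t * y)"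
    and D_t: "D t = t * (s * x + t * y)"
    and D_x: "D x = (s + t) * x * y"
    and D_y: "D y = (s + t) * x * y"
begin

abbreviation W where "W \<equiv> tree_weight s t x y"
abbreviation WF where "WF \<equiv> forest_weight s t x y"

lemma D_one: "D 1 = 0"
  using D_mult[of 1 1] by simp

lemma D_zero: "D 0 = 0"
  using D_add[of 0 0] by simp

lemma D_sum: "D (sum f A) = (\<Sum>i\<in>A. D (f i))"
  by (induction A rule: infinite_finite_induct) (simp_all add: D_zero D_add)

text \<open>For forests, the terms \<open>ty\<close> produced by the edges to the roots are missing: they come from
  splitting the parent.\<close>

lemma sum_list_insert_label:
  "\<forall>i\<in>set (labels u). i < m \<Longrightarrow> sum_list (map W (insert_label m u)) = D (W u)"
  "\<forall>i\<in>set (forest_labels us). i < m \<Longrightarrow> a < m \<Longrightarrow>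
     sum_list (map (WF a) (insert_label_forest m us)) =
       D (WF a us) + (s * x - of_nat (length us) * t * y) * WF a us"
proof (induction m u and m us arbitrary: and a rule: insert_label_insert_label_forest.induct)
  case (1 m i ts)
  \<comment> \<open>After the insertion \<open>i\<close> is internal, so its factor is
    \<open>y\<close> even if it was a leaf.\<close>
  have ne: "ts' \<noteq> []" if "ts' \<in> set (insert_label_forest m ts)" for ts'
    using mset_labels_insert_label(2)[OF that] by auto
  have IH: "sum_list (map (WF i) (insert_label_forest m ts)) =
       D (WF i ts) + (s * x - of_nat (length ts) * t * y) * WF i ts"
    using 1 by simp
  have "map (W \<circ> Node i) (insert_label_forest m ts) = map (\<lambda>ts'. y * WF i ts') (insert_label_forest m ts)"
    using ne by auto
  then have "sum_list (map (W \<circ> Node i) (insert_label_forest m ts)) =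
      y * (D (WF i ts) + (s * x - of_nat (length ts) * t * y) * WF i ts)"
    by (simp only: sum_list_const_mult IH)
  then have "sum_list (map W (insert_label m (Node i ts))) =
      t * y * (x + of_nat (length ts) * y) * WF i ts
      + y * (D (WF i ts) + (s * x - of_nat (length ts) * t * y) * WF i ts)"
    using sum_list_weight_split[of i m s t x y ts] 1(2)
    by (simp add: o_def del: upt_Suc tree_weight.simps)
  \<comment> \<open>The terms with \<open>length ts\<close> cancel, leaving
    \<open>(s + t) * x * y\<close> for the root, the common value of \<open>D x\<close> and
    \<open>D y\<close>.\<close>
  also have "\<dots> = D (W (Node i ts))"
    by (cases "ts = []") (simp_all add: D_mult D_x D_y D_one algebra_simps)
  finally show ?case .
next
  case (2 m)
  then show ?case by (simp add: D_one beta_def)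
next
  case (3 m u us)
  let ?e = "if a < beta u then s else t" and ?b = "min a (beta u)"
  have De: "D ?e = ?e * (s * x + t * y)" by (simp add: D_s D_t)
  have lt: "?b < m" using 3 by simp
  have IH1: "sum_list (map W (insert_label m u)) = D (W u)"
    using 3 by simp
  have IH2: "sum_list (map (WF ?b) (insert_label_forest m us)) =
       D (WF ?b us) + (s * x - of_nat (length us) * t * y) * WF ?b us"
    using 3 by simp
  \<comment> \<open>Since \<open>beta u\<close> is unchanged, so are the edge to \<open>u\<close>
    and the \<alpha> passed on to \<open>us\<close>.\<close>
  have a: "map (WF a \<circ> (\<lambda>u'. u' # us)) (insert_label m u) =
      map (\<lambda>u'. ?e * WF ?b us * W u') (insert_label m u)"
    using 3(3) beta_insert_label[of _ m u] by (auto simp: ac_simps)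
  have b: "map (WF a \<circ> (#) u) (insert_label_forest m us) =
      map (\<lambda>us'. ?e * W u * WF ?b us') (insert_label_forest m us)"
    by simp
  \<comment> \<open>The new edge is proper since \<open>a < m\<close>, and \<open>m\<close> does not
    lower the \<alpha> of later siblings.\<close>
  have c: "WF a (Node m [] # u # us) = s * x * WF a (u # us)"
    using 3(4) by (simp add: beta_def min_absorb1)
  have "sum_list (map (WF a) (insert_label_forest m (u # us))) =
      s * x * WF a (u # us) + ?e * WF ?b us * D (W u)
      + ?e * W u * (D (WF ?b us) + (s * x - of_nat (length us) * t * y) * WF ?b us)"
    using c by (simp only: insert_label_forest.simps list.map map_append map_map a b sum_list.Cons
        sum_list_append sum_list_const_mult IH1 IH2 add.assoc)
  \<comment> \<open>In \<open>D ?e\<close>, the part \<open>s * x\<close> matches the gap before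
    \<open>u\<close>, and \<open>t * y\<close> is cancelled by the increase of the length by
    one.\<close>
  also have "\<dots> = D (WF a (u # us)) + (s * x - of_nat (length (u # us)) * t * y) * WF a (u # us)"
    unfolding forest_weight.simps D_mult De by (simp add: algebra_simps del: if_split)
  finally show ?case .
qed

text \<open>The one-node tree has weight \<open>x\<close>, not \<open>y\<close>, but
  \<open>D x = D y\<close>; so the iteration agrees with tree sums from the first derivative
  on.\<close>

lemma iterate_D_y:
  "(D ^^ Suc n) y = sum W (trees_on {1..Suc n + 1})"
proof -
  have base: "trees_on {1} = {Node 1 []}"
  proof (intro equalityI subsetI)
    fix u assume "u \<in> trees_on {1}"
    moreover obtain i ts where u: "u = Node i ts" by (cases u)
    ultimately have "distinct (labels u)" "i = 1" "set (forest_labels ts) \<subseteq> {1}"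
      "1 \<notin> set (forest_labels ts)"
      by (auto simp: trees_on_def)
    then have "forest_labels ts = []" by (metis set_empty subset_singletonD singletonI)
    then have "ts = []" by (cases ts) auto
    then show "u \<in> {Node 1 []}" using u \<open>i = 1\<close> by simp
  qed (auto simp: trees_on_def)
  have step: "D (sum W (trees_on {1..Suc n})) = sum W (trees_on {1..Suc (Suc n)})" for n
  proof -
    have "sum W (trees_on (insert (Suc (Suc n)) {1..Suc n})) =
        (\<Sum>u\<in>trees_on {1..Suc n}. sum_list (map W (insert_label (Suc (Suc n)) u)))"
      by (rule sum_trees_on_insert) auto
    also have "\<dots> = (\<Sum>u\<in>trees_on {1..Suc n}. D (W u))"
      by (intro sum.cong refl sum_list_insert_label) (auto simp: trees_on_def)
    finally show ?thesis by (simp add: D_sum atLeastAtMostSuc_conv)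
  qed
  show ?thesis
  proof (induction n)
    case 0
    have "(D ^^ Suc 0) y = D (sum W (trees_on {1..Suc 0}))"
      using base by (simp add: D_x D_y)
    then show ?case using step[of 0] by simp
  next
    case (Suc n)
    then show ?case using step[of "Suc n"] by simp
  qed
qed

end

section \<open>Weights in terms of leaves and improper edges\<close>

text \<open>Absorbing the first sibling into the parent's label turns the indexed definition of
  improper edges into the recursion of \<open>forest_weight\<close>.\<close>

lemma card_improper_Cons:
  "card {j. j < length (u # us) \<and> \<not> proper a (u # us) j} =
     (if a < beta u then 0 else 1) + card {j. j < length us \<and> \<not> proper (min a (beta u)) us j}"
proof -
  have eq: "proper a (u # us) (Suc j) = proper (min a (beta u)) us j" for j
    by (simp add: proper_def alpha_def beta_Node_Cons del: list.set image_insert)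
  have z: "proper a (u # us) 0 \<longleftrightarrow> a < beta u"
    by (simp add: proper_def alpha_def)
  have "{j. j < length (u # us) \<and> \<not> proper a (u # us) j} =
      (if a < beta u then {} else {0}) \<union> Suc ` {j. j < length us \<and> \<not> proper (min a (beta u)) us j}"
    by (auto simp: image_iff z eq less_Suc_eq_0_disj)
  then show ?thesis
    by (simp add: card_image card_insert_if)
qed

text \<open>The exponents are fixed by sums to avoid truncated subtraction. A tree has one edge
  fewer than nodes; a forest includes the edges to its roots, so there the numbers agree.\<close>

lemma weight_eq:
  fixes s t x y :: "'b::comm_semiring_1"
  shows "\<exists>p q. p + improper_edges u + 1 = length (labels u) \<and> q + leaves u = length (labels u) \<and>
     tree_weight s t x y u = s ^ p * t ^ improper_edges u * x ^ leaves u * y ^ q"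
   "\<exists>p q. p + (card {j. j < length us \<and> \<not> proper a us j} + sum_list (map improper_edges us))
         = length (forest_labels us) \<and>
      q + sum_list (map leaves us) = length (forest_labels us) \<and>
      forest_weight s t x y a us = s ^ p
        * t ^ (card {j. j < length us \<and> \<not> proper a us j} + sum_list (map improper_edges us))
        * x ^ sum_list (map leaves us) * y ^ q"
proof (induction s t x y u and s t x y a us rule: tree_weight_forest_weight.induct)
  case (1 s t x y i us)
  then obtain p q where
    pq: "p + improper_edges (Node i us) + 1 = length (labels (Node i us))"
      "q + sum_list (map leaves us) = length (forest_labels us)"
      "forest_weight s t x y i us = s ^ p * t ^ improper_edges (Node i us)
        * x ^ sum_list (map leaves us) * y ^ q"
    by auto
  show ?case
  proof (cases "us = []")
    case True
    with pq show ?thesis by (intro exI[of _ 0]) simp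
  next
    case False
    with pq show ?thesis
      by (intro exI[of _ p] exI[of _ "Suc q"]) (simp add: ac_simps)
  qed
next
  case (2 s t x y a)
  then show ?case by simp
next
  case (3 s t x y a u us)
  let ?r = "card {j. j < length us \<and> \<not> proper (min a (beta u)) us j}"
  from 3 obtain p q p' q' where
    pq: "p + improper_edges u + 1 = length (labels u)" "q + leaves u = length (labels u)"
      "tree_weight s t x y u = s ^ p * t ^ improper_edges u * x ^ leaves u * y ^ q"
      "p' + (?r + sum_list (map improper_edges us)) = length (forest_labels us)"
      "q' + sum_list (map leaves us) = length (forest_labels us)"
      "forest_weight s t x y (min a (beta u)) us = s ^ p' *
        t ^ (?r + sum_list (map improper_edges us)) * x ^ sum_list (map leaves us) * y ^ q'"
    by blast
  define r where "r = ?r"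
  show ?case
    unfolding card_improper_Cons r_def[symmetric]
    using pq[folded r_def]
    by (intro exI[of _ "p + p' + (if a < beta u then 1 else 0)"] exI[of _ "q + q'"])
      (cases "a < beta u"; simp add: power_add ac_simps)
qed

lemma leaves_pos: "leaves u \<ge> 1"
proof (induction u)
  case (Node i us)
  show ?case
  proof (cases us)
    case (Cons v vs)
    then have "leaves v \<ge> 1" using Node by simp
    then show ?thesis using Cons by simp
  qed simp
qed

lemma leaves_less:
  assumes "length (labels u) \<ge> 2"
  shows "leaves u < length (labels u)"
proof -
  obtain i us where u: "u = Node i us" by (cases u)
  then have "us \<noteq> []" using assms by auto
  then show ?thesis
    \<comment> \<open>Only the node count is wanted, so all weights are set to 1; the internal root
      makes the inequality strict.\<close>
    using weight_eq(2)[of us i 1 1 1 "1::nat"] u by auto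
qed

text \<open>Trees are grouped by leaves and improper edges. For \<open>n \<ge> 1\<close> the root is
  internal, so there are at most \<open>n\<close> leaves and the index ranges miss no tree.\<close>

lemma sum_weight_eq_N_tilde_A:
  fixes s t x y :: "'b::comm_semiring_1"
  assumes "n \<ge> 1"
  shows "sum (tree_weight s t x y) (labeled_plane_trees (n + 1)) = N_tilde_A n x y s t"
proof -
  let ?L = "labeled_plane_trees (n + 1)"
  let ?g = "\<lambda>k r. s ^ (n - r) * t ^ r * x ^ k * y ^ (n - k + 1)"
  have len: "length (labels u) = n + 1" if "u \<in> ?L" for u
    using that distinct_card[of "labels u"] by (simp add: labeled_plane_trees_def)
  have w: "leaves u \<in> {1..n}" "improper_edges u \<in> {0..n}"
    "tree_weight s t x y u = ?g (leaves u) (improper_edges u)" if u: "u \<in> ?L" for u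
  proof -
    show l: "leaves u \<in> {1..n}"
      using leaves_pos[of u] leaves_less[of u] len[OF u] assms by simp
    obtain p q where pq: "p + improper_edges u + 1 = n + 1" "q + leaves u = n + 1"
      "tree_weight s t x y u = s ^ p * t ^ improper_edges u * x ^ leaves u * y ^ q"
      using weight_eq(1)[of u s t x y] len[OF u] by auto
    show "improper_edges u \<in> {0..n}" using pq by simp
    have "p = n - improper_edges u" "q = n - leaves u + 1" using pq l by auto
    then show "tree_weight s t x y u = ?g (leaves u) (improper_edges u)" using pq(3) by simp
  qed
  have "N_tilde_A n x y s t = (\<Sum>k=1..n. \<Sum>r=0..n. of_nat (N_tilde n k r) * ?g k r)"
    using assms by (simp add: N_tilde_A_def mult.assoc)
  also have "\<dots> = (\<Sum>(k, r)\<in>{1..n} \<times> {0..n}. of_nat (N_tilde n k r) * ?g k r)"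
    by (rule sum.cartesian_product)
  also have "\<dots> = (\<Sum>z\<in>{1..n} \<times> {0..n}.
      \<Sum>u\<in>{u \<in> ?L. (leaves u, improper_edges u) = z}. tree_weight s t x y u)"
  proof (intro sum.cong refl, clarify)
    fix k r
    have "(\<Sum>u\<in>{u \<in> ?L. (leaves u, improper_edges u) = (k, r)}. tree_weight s t x y u)
        = (\<Sum>u\<in>{u \<in> ?L. leaves u = k \<and> improper_edges u = r}. ?g k r)"
      using w(3) by (intro sum.cong) auto
    then show "of_nat (N_tilde n k r) * ?g k r =
        (\<Sum>u\<in>{u \<in> ?L. (leaves u, improper_edges u) = (k, r)}. tree_weight s t x y u)"
      by (simp add: N_tilde_def)
  qed
  also have "\<dots> = sum (tree_weight s t x y) ?L"
  proof (rule sum.group)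
    show "finite ?L" by (rule finite_labeled_plane_trees)
    show "(\<lambda>u. (leaves u, improper_edges u)) ` ?L \<subseteq> {1..n} \<times> {0..n}"
      using w(1,2) by blast
  qed simp
  finally show ?thesis by simp
qed

theorem theorem3:
  fixes D :: "(gvar, 'a::comm_ring_1) laurent \<Rightarrow> (gvar, 'a) laurent" and n :: nat
  assumes "formal_derivative grammar_G D"
  shows "(D ^^ n) (var Y) = N_tilde_A n (var X) (var Y) (var S) (var T)"
proof (cases n)
  case 0
  then show ?thesis by (simp add: N_tilde_A_def)
next
  case (Suc k)
  interpret grammar_derivation D "var S" "var T" "var X" "var Y"
    by standard (simp_all add: formal_derivativeD[OF assms])
  have "(D ^^ n) (var Y) = sum W (labeled_plane_trees (n + 1))"
    unfolding Suc iterate_D_y trees_on_def labeled_plane_trees_def ..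
  then show ?thesis using sum_weight_eq_N_tilde_A[of n] Suc by simp
qed

end
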